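(* Let $P$ be an arbitrary partially ordered set and $R$ a commutative unital ring. The Poisson structures $B$ on the finitary incidence algebra $FI(P,R)$ are in a one-to-one correspondence with the maps $\sigma:P^2_<\to R$ which are constant on chains. The correspondence is given by $$B(f,g)(x,y)=\begin{cases}0, & x=y,\\ \sigma(x,y)\,[f,g](x,y), & x<y,\end{cases}$$ for all $f,g\in FI(P,R)$ and all $x\le y$ in $P$, where $[f,g]=fg-gf$.
   Context: Let $(P,\le)$ be a poset and $R$ a commutative unital ring. $I(P,R)$ is the $R$-module of formal sums $f=\sum_{x\le y}f(x,y)e_{xy}$ with $f(x,y)\in R$, where $e_{xy}$ is a symbol attached to each pair $x\le y$ in $P$. Such $f$ is a finitary series if for every $x<y$ in $P$ there are only finitely many pairs $u,v\in P$ with $x\le u<v\le y$ and $f(u,v)\ne 0$. $FI(P,R)\subseteq I(P,R)$ is the set of finitary series; it is an associative unital $R$-algebra (the finitary incidence algebra of $P$ over $R$) under $(fg)(x,y)=\sum_{x\le z\le y}f(x,z)g(z,y)$. A Poisson structure on an associative $R$-algebra $A$ is an $R$-bilinear operation $\{\cdot,\cdot\}:A\times A\to A$ such that $(A,\{\cdot,\cdot\})$ is a Lie algebra and $\{a,bc\}=\{a,b\}c+b\{a,c\}$ for all $a,b,c\in A$. $P^2_<=\{(x,y)\in P^2\mid x<y\}$. A map $\sigma:P^2_<\to R$ is constant on chains if for every chain $C\subseteq P$ and all $x<y$, $u<v$ in $C$ one has $\sigma(x,y)=\sigma(u,v)$. *)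

theory Defs
  imports "HOL-Library.FuncSet" "HOL-Library.Function_Algebras"
begin

text \<open>
  A poset is a set \<open>P\<close> of elements of an ordered type, with the induced order; \<open>P\<close> may be empty.
  The coefficient ring is a type of sort \<open>{comm_ring, comm_monoid_mult}\<close>, that is, a commutative
  unital ring; unlike \<open>comm_ring_1\<close> this sort does not exclude the zero ring.
\<close>

text \<open>
  The formal sum with coefficients \<open>f(x,y)\<close>, for \<open>x \<le> y\<close> in \<open>P\<close>, is represented by the function
  \<open>f\<close> extended by \<open>0\<close> to all other pairs.
\<close>

definition incidence_space ::
    "'p::order set \<Rightarrow> ('p \<Rightarrow> 'p \<Rightarrow> 'r::{comm_ring,comm_monoid_mult}) set"
  where "incidence_space P = {f. \<forall>x y. \<not> (x \<in> P \<and> y \<in> P \<and> x \<le> y) \<longrightarrow> f x y = 0}"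

definition FI :: "'p::order set \<Rightarrow> ('p \<Rightarrow> 'p \<Rightarrow> 'r::{comm_ring,comm_monoid_mult}) set"
  where "FI P = {f \<in> incidence_space P. \<forall>x\<in>P. \<forall>y\<in>P. x < y \<longrightarrow>
           finite {(u, v). u \<in> P \<and> v \<in> P \<and> x \<le> u \<and> u < v \<and> v \<le> y \<and> f u v \<noteq> 0}}"

text \<open>
  Addition, subtraction and zero on \<open>FI P\<close> are the pointwise ones provided by
  \<^theory>\<open>HOL-Library.Function_Algebras\<close>; the operation \<open>*\<close> of that theory is the pointwise product
  and not the product of the algebra.

  An interval of \<open>P\<close> may be infinite, and \<open>sum\<close> over an infinite set is \<open>0\<close> by convention, so
  the sum below runs over the nonzero terms only. For \<open>f\<close> and \<open>g\<close> in \<open>FI P\<close> there are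
  finitely many of them.
\<close>

definition fi_mult :: "'p::order set \<Rightarrow> ('p \<Rightarrow> 'p \<Rightarrow> 'r) \<Rightarrow> ('p \<Rightarrow> 'p \<Rightarrow> 'r)
    \<Rightarrow> 'p \<Rightarrow> 'p \<Rightarrow> 'r::{comm_ring,comm_monoid_mult}"
  where "fi_mult P f g x y =
           (\<Sum>z | z \<in> P \<and> x \<le> z \<and> z \<le> y \<and> f x z * g z y \<noteq> 0. f x z * g z y)"

definition fi_scale :: "'r::{comm_ring,comm_monoid_mult} \<Rightarrow> ('p \<Rightarrow> 'p \<Rightarrow> 'r) \<Rightarrow> 'p \<Rightarrow> 'p \<Rightarrow> 'r"
  where "fi_scale r f = (\<lambda>x y. r * f x y)"

definition fi_commutator :: "'p::order set \<Rightarrow> ('p \<Rightarrow> 'p \<Rightarrow> 'r) \<Rightarrow> ('p \<Rightarrow> 'p \<Rightarrow> 'r)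
    \<Rightarrow> 'p \<Rightarrow> 'p \<Rightarrow> 'r::{comm_ring,comm_monoid_mult}"
  where "fi_commutator P f g = fi_mult P f g - fi_mult P g f"

text \<open>
  In the following, \<open>A\<close> is the carrier of an algebra inside an additive group, \<open>mul\<close> is its
  product and \<open>scale\<close> its scalar multiplication, with all elements of \<open>'r\<close> as scalars.
\<close>

definition bilinear_on :: "'a::ab_group_add set \<Rightarrow> ('r \<Rightarrow> 'a \<Rightarrow> 'a) \<Rightarrow> ('a \<times> 'a \<Rightarrow> 'a) \<Rightarrow> bool"
  where "bilinear_on A scale B \<longleftrightarrow>
    (\<forall>a\<in>A. \<forall>b\<in>A. \<forall>c\<in>A. B (a + b, c) = B (a, c) + B (b, c)) \<and>
    (\<forall>a\<in>A. \<forall>b\<in>A. \<forall>c\<in>A. B (a, b + c) = B (a, b) + B (a, c)) \<and>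
    (\<forall>r. \<forall>a\<in>A. \<forall>b\<in>A. B (scale r a, b) = scale r (B (a, b))) \<and>
    (\<forall>r. \<forall>a\<in>A. \<forall>b\<in>A. B (a, scale r b) = scale r (B (a, b)))"

definition lie_bracket_on :: "'a::ab_group_add set \<Rightarrow> ('r \<Rightarrow> 'a \<Rightarrow> 'a) \<Rightarrow> ('a \<times> 'a \<Rightarrow> 'a) \<Rightarrow> bool"
  where "lie_bracket_on A scale B \<longleftrightarrow>
    B \<in> A \<times> A \<rightarrow> A \<and> bilinear_on A scale B \<and>
    (\<forall>a\<in>A. B (a, a) = 0) \<and>
    (\<forall>a\<in>A. \<forall>b\<in>A. \<forall>c\<in>A. B (a, B (b, c)) + B (b, B (c, a)) + B (c, B (a, b)) = 0)"

definition poisson_structure_on :: "'a::ab_group_add set \<Rightarrow> ('a \<Rightarrow> 'a \<Rightarrow> 'a) \<Rightarrow> ('r \<Rightarrow> 'a \<Rightarrow> 'a)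
    \<Rightarrow> ('a \<times> 'a \<Rightarrow> 'a) \<Rightarrow> bool"
  where "poisson_structure_on A mul scale B \<longleftrightarrow>
    lie_bracket_on A scale B \<and>
    (\<forall>a\<in>A. \<forall>b\<in>A. \<forall>c\<in>A. B (a, mul b c) = mul (B (a, b)) c + mul b (B (a, c)))"

definition strict_pairs :: "'p::order set \<Rightarrow> ('p \<times> 'p) set"
  where "strict_pairs P = {(x, y). x \<in> P \<and> y \<in> P \<and> x < y}"

definition constant_on_chains :: "'p::order set \<Rightarrow> ('p \<times> 'p \<Rightarrow> 'r) \<Rightarrow> bool"
  where "constant_on_chains P \<sigma> \<longleftrightarrow>
    (\<forall>C. C \<subseteq> P \<longrightarrow> Complete_Partial_Order.chain (\<le>) C \<longrightarrow>
      (\<forall>x\<in>C. \<forall>y\<in>C. \<forall>u\<in>C. \<forall>v\<in>C. x < y \<longrightarrow> u < v \<longrightarrow> \<sigma> (x, y) = \<sigma> (u, v)))"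

end

theory Submission
  imports Defs
begin

text \<open>
  Write \<open>e\<^sub>x = e\<^sub>x\<^sub>x\<close>. For a derivation \<open>D\<close>, expanding \<open>D(e\<^sub>x f e\<^sub>y) = f(x,y) D(e\<^sub>x\<^sub>y)\<close> expresses
  \<open>D(f)(x,y)\<close> through \<open>D(e\<^sub>x\<^sub>y)(x,y)\<close>, \<open>D(e\<^sub>x)\<close> and \<open>D(e\<^sub>y)\<close>. Since a Poisson bracket \<open>B\<close> is a
  derivation in both arguments, and \<open>B(e\<^sub>x,e\<^sub>y) = 0\<close>, using this twice determines \<open>B\<close> by
  the values \<open>\<sigma>(x,y) = B(e\<^sub>x,e\<^sub>x\<^sub>y)(x,y)\<close>. Applying the Leibniz rule to \<open>e\<^sub>x\<^sub>w = e\<^sub>x\<^sub>y e\<^sub>y\<^sub>w\<close> gives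
  \<open>\<sigma>(x,y) = \<sigma>(x,w) = \<sigma>(y,w)\<close> for \<open>x < y < w\<close>, so \<open>\<sigma>\<close> is constant on chains. Conversely, if \<open>\<sigma>\<close>
  is constant on chains, it acts as a scalar in each interval, and the axioms reduce
  to those of the commutator.
\<close>

section \<open>The finitary incidence algebra\<close>

lemma FI_zero:
  assumes "f \<in> FI P" "\<not> (x \<in> P \<and> y \<in> P \<and> x \<le> y)"
  shows "f x y = 0"
  using assms by (auto simp: FI_def incidence_space_def)

lemma FI_nonzeroD:
  assumes "f \<in> FI P" "f x y \<noteq> 0"
  shows "x \<in> P" "y \<in> P" "x \<le> y"
  using FI_zero[OF assms(1)] assms(2) by blast+

lemma FI_eqI:
  assumes "f \<in> FI P" "g \<in> FI P"
    and "\<And>x y. x \<in> P \<Longrightarrow> y \<in> P \<Longrightarrow> x \<le> y \<Longrightarrow> f x y = g x y"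
  shows "f = g"
  using FI_zero[OF assms(1)] FI_zero[OF assms(2)] assms(3) by (intro ext) metis

text \<open>Nonzero coefficients already force \<open>u\<close> and \<open>v\<close> into
  \<open>P\<close>. Placing the condition on the endpoints inside the set makes finiteness
  unconditional: if it or \<open>x < y\<close> fails, the set is empty.\<close>

lemma FI_finite_pairs:
  assumes "f \<in> FI P"
  shows "finite {(u, v). x \<le> u \<and> u < v \<and> v \<le> y \<and> f u v \<noteq> 0 \<and> x \<in> P \<and> y \<in> P}" (is "finite ?S")
proof (cases "x \<in> P \<and> y \<in> P \<and> x < y")
  case True
  then have "finite {(u, v). u \<in> P \<and> v \<in> P \<and> x \<le> u \<and> u < v \<and> v \<le> y \<and> f u v \<noteq> 0}"
    using assms by (auto simp: FI_def)
  then show ?thesis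
    by (rule rev_finite_subset) (use FI_nonzeroD[OF assms] in auto)
next
  case False
  then have "?S = {}" by (auto dest: order.strict_trans1 order.strict_trans2)
  then show ?thesis by (metis finite.emptyI)
qed

lemma FI_I:
  assumes "\<And>x y. \<not> (x \<in> P \<and> y \<in> P \<and> x \<le> y) \<Longrightarrow> f x y = 0"
    and "\<And>x y. x \<in> P \<Longrightarrow> y \<in> P \<Longrightarrow> x < y \<Longrightarrow>
      finite {(u, v). x \<le> u \<and> u < v \<and> v \<le> y \<and> f u v \<noteq> 0}"
  shows "f \<in> FI P"
  unfolding FI_def incidence_space_def
  using assms(1) by (auto intro: rev_finite_subset[OF assms(2)])

text \<open>Intervals may be infinite, but apart from \<open>z = x\<close> every nonzero entry of
  row \<open>x\<close> up to \<open>y\<close> comes from a pair \<open>(x, z)\<close> counted by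
  finitarity. Such rows, and dually columns, supply finite index sets for computing with
  products.\<close>

lemma FI_finite_row:
  assumes "f \<in> FI P" "x \<in> P" "y \<in> P"
  shows "finite {z. z \<le> y \<and> f x z \<noteq> 0}"
proof -
  let ?S = "{(u, v). x \<le> u \<and> u < v \<and> v \<le> y \<and> f u v \<noteq> 0 \<and> x \<in> P \<and> y \<in> P}"
  have "{z. z \<le> y \<and> f x z \<noteq> 0} \<subseteq> insert x (snd ` ?S)"
    using assms FI_nonzeroD(3)[OF assms(1)] by (force simp: less_le)
  then show ?thesis
    by (rule finite_subset) (use FI_finite_pairs[OF assms(1)] in simp)
qed

lemma FI_finite_column:
  assumes "f \<in> FI P" "x \<in> P" "y \<in> P"
  shows "finite {z. x \<le> z \<and> f z y \<noteq> 0}"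
proof -
  let ?S = "{(u, v). x \<le> u \<and> u < v \<and> v \<le> y \<and> f u v \<noteq> 0 \<and> x \<in> P \<and> y \<in> P}"
  have "{z. x \<le> z \<and> f z y \<noteq> 0} \<subseteq> insert y (fst ` ?S)"
    using assms FI_nonzeroD(3)[OF assms(1)] by (force simp: less_le)
  then show ?thesis
    by (rule finite_subset) (use FI_finite_pairs[OF assms(1)] in simp)
qed

lemma FI_0: "0 \<in> FI P"
  by (rule FI_I) auto

lemma FI_add:
  assumes "f \<in> FI P" "g \<in> FI P"
  shows "f + g \<in> FI P"
proof (rule FI_I)
  fix x y assume "x \<in> P" "y \<in> P"
  then have "finite ({(u, v). x \<le> u \<and> u < v \<and> v \<le> y \<and> f u v \<noteq> 0} \<union>
      {(u, v). x \<le> u \<and> u < v \<and> v \<le> y \<and> g u v \<noteq> 0})"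
    using FI_finite_pairs[OF assms(1), of x y] FI_finite_pairs[OF assms(2), of x y] by simp
  then show "finite {(u, v). x \<le> u \<and> u < v \<and> v \<le> y \<and> (f + g) u v \<noteq> 0}"
    by (rule rev_finite_subset) auto
qed (use FI_zero[OF assms(1)] FI_zero[OF assms(2)] in auto)

text \<open>Coefficientwise weights never enlarge the support, whatever \<open>w\<close> is. This
  covers scalar multiples as well as commutators weighted by \<sigma>.\<close>

lemma FI_weighted:
  assumes "f \<in> FI P"
  shows "(\<lambda>x y. w x y * f x y) \<in> FI P"
proof (rule FI_I)
  fix x y assume "x \<in> P" "y \<in> P"
  then show "finite {(u, v). x \<le> u \<and> u < v \<and> v \<le> y \<and> w u v * f u v \<noteq> 0}"
    using FI_finite_pairs[OF assms, of x y] by (auto elim: rev_finite_subset)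
qed (use FI_zero[OF assms] in auto)

lemma FI_scale: "f \<in> FI P \<Longrightarrow> fi_scale r f \<in> FI P"
  unfolding fi_scale_def by (rule FI_weighted)

lemma FI_diff:
  assumes "f \<in> FI P" "g \<in> FI P"
  shows "f - g \<in> FI P"
proof -
  have "f - g = f + fi_scale (- 1) g" by (simp add: fi_scale_def fun_eq_iff)
  then show ?thesis using FI_add[OF assms(1) FI_scale[OF assms(2)]] by metis
qed

text \<open>The index set in \<open>fi_mult\<close> depends on both factors. Passing to any finite
  set that contains the nonzero terms lets several products share one index set.\<close>

lemma fi_mult_eq_sum:
  assumes "f \<in> FI P" "g \<in> FI P" "finite S" "\<And>z. f x z * g z y \<noteq> 0 \<Longrightarrow> z \<in> S"
  shows "fi_mult P f g x y = (\<Sum>z\<in>S. f x z * g z y)"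
  unfolding fi_mult_def
proof (rule sum.mono_neutral_left[OF assms(3)])
  show "\<forall>z\<in>S - {z \<in> P. x \<le> z \<and> z \<le> y \<and> f x z * g z y \<noteq> 0}. f x z * g z y = 0"
  proof
    fix z assume "z \<in> S - {z \<in> P. x \<le> z \<and> z \<le> y \<and> f x z * g z y \<noteq> 0}"
    then show "f x z * g z y = 0"
      using FI_nonzeroD[OF assms(1), of x z] FI_nonzeroD[OF assms(2), of z y] by fastforce
  qed
qed (use assms(4) in auto)

lemma fi_mult_cong:
  assumes "\<And>z. z \<in> P \<Longrightarrow> x \<le> z \<Longrightarrow> z \<le> y \<Longrightarrow> f x z * g z y = f' x z * g' z y"
  shows "fi_mult P f g x y = fi_mult P f' g' x y"
  unfolding fi_mult_def using assms by (intro sum.cong) auto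

lemma fi_mult_zero: "fi_mult P 0 f = 0" "fi_mult P f 0 = 0"
  by (simp_all add: fi_mult_def fun_eq_iff)

lemma fi_mult_outside:
  assumes "\<not> (x \<in> P \<and> y \<in> P \<and> x \<le> y)" "f \<in> FI P" "g \<in> FI P"
  shows "fi_mult P f g x y = 0"
proof -
  have "f x z * g z y = 0" for z
  proof (rule ccontr)
    assume "f x z * g z y \<noteq> 0"
    then have "f x z \<noteq> 0" "g z y \<noteq> 0" by auto
    then show False
      using assms(1) FI_nonzeroD[OF assms(2)] FI_nonzeroD[OF assms(3)] order_trans by metis
  qed
  then have "{z \<in> P. x \<le> z \<and> z \<le> y \<and> f x z * g z y \<noteq> 0} = {}" by blast
  then show ?thesis by (simp only: fi_mult_def sum.empty)
qed

text \<open>The set depends on the left factor only and can be kept while \<open>g\<close> varies;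
  \<open>fi_mult_column\<close> is the dual, for varying \<open>f\<close>. Linearity in each
  argument then becomes a computation with finite sums.\<close>

lemma fi_mult_row:
  assumes "f \<in> FI P" "g \<in> FI P" "x \<in> P" "y \<in> P"
    "finite S" "{z. z \<le> y \<and> f x z \<noteq> 0} \<subseteq> S"
  shows "fi_mult P f g x y = (\<Sum>z\<in>S. f x z * g z y)"
proof (rule fi_mult_eq_sum)
  fix z assume "f x z * g z y \<noteq> 0"
  then have "f x z \<noteq> 0" "g z y \<noteq> 0" by auto
  then show "z \<in> S" using assms FI_nonzeroD(3)[OF assms(2)] by blast
qed (fact assms)+

lemma fi_mult_column:
  assumes "f \<in> FI P" "g \<in> FI P" "x \<in> P" "y \<in> P"
    "finite S" "{z. x \<le> z \<and> g z y \<noteq> 0} \<subseteq> S"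
  shows "fi_mult P f g x y = (\<Sum>z\<in>S. f x z * g z y)"
proof (rule fi_mult_eq_sum)
  fix z assume "f x z * g z y \<noteq> 0"
  then have "f x z \<noteq> 0" "g z y \<noteq> 0" by auto
  then show "z \<in> S" using assms FI_nonzeroD(3)[OF assms(1)] by blast
qed (fact assms)+

lemma fi_mult_nonzeroE:
  assumes "fi_mult P f g x y \<noteq> 0"
  obtains z where "x \<le> z" "z \<le> y" "f x z \<noteq> 0" "g z y \<noteq> 0"
proof -
  obtain z where "x \<le> z" "z \<le> y" "f x z * g z y \<noteq> 0"
    using assms unfolding fi_mult_def by (auto elim!: sum.not_neutral_contains_not_neutral)
  then show ?thesis using that[of z] by (metis mult_zero_left mult_zero_right)
qed

text \<open>A nonzero entry of the product at \<open>(u, v)\<close> has a witness \<open>z\<close>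
  with \<open>f u z\<close> and \<open>g z v\<close> nonzero. If \<open>z = u\<close>, the pair is
  in \<open>G\<close>; if \<open>z = v\<close>, it is in \<open>F\<close>; if \<open>z\<close> lies
  strictly between, \<open>u\<close> starts a pair of \<open>F\<close> and \<open>v\<close> ends a
  pair of \<open>G\<close>.\<close>

lemma FI_mult:
  assumes "f \<in> FI P" "g \<in> FI P"
  shows "fi_mult P f g \<in> FI P"
proof (rule FI_I)
  fix x y assume xy: "x \<in> P" "y \<in> P"
  define F where "F = {(u, v). x \<le> u \<and> u < v \<and> v \<le> y \<and> f u v \<noteq> 0}"
  define G where "G = {(u, v). x \<le> u \<and> u < v \<and> v \<le> y \<and> g u v \<noteq> 0}"
  have "finite (F \<union> G \<union> fst ` F \<times> snd ` G)"
    unfolding F_def G_def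
    using FI_finite_pairs[OF assms(1), of x y] FI_finite_pairs[OF assms(2), of x y] xy by simp
  moreover have "{(u, v). x \<le> u \<and> u < v \<and> v \<le> y \<and> fi_mult P f g u v \<noteq> 0}
      \<subseteq> F \<union> G \<union> fst ` F \<times> snd ` G"
  proof clarify
    fix u v assume uv: "x \<le> u" "u < v" "v \<le> y" "fi_mult P f g u v \<noteq> 0" "(u, v) \<notin> G"
      "\<not> (u \<in> fst ` F \<and> v \<in> snd ` G)"
    from uv(4) obtain z where z: "u \<le> z" "z \<le> v" "f u z \<noteq> 0" "g z v \<noteq> 0"
      by (rule fi_mult_nonzeroE)
    have "z \<noteq> u" using uv z by (auto simp: G_def)
    moreover have "z = v"
    proof (rule ccontr)
      assume "z \<noteq> v"
      then have "(u, z) \<in> F" "(z, v) \<in> G"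
        using uv z \<open>z \<noteq> u\<close> by (auto simp: F_def G_def)
      then show False using uv(6) by force
    qed
    ultimately show "(u, v) \<in> F" using uv z by (auto simp: F_def)
  qed
  ultimately show "finite {(u, v). x \<le> u \<and> u < v \<and> v \<le> y \<and> fi_mult P f g u v \<noteq> 0}"
    by (rule rev_finite_subset)
qed (rule fi_mult_outside[OF _ assms])

lemma FI_commutator: "f \<in> FI P \<Longrightarrow> g \<in> FI P \<Longrightarrow> fi_commutator P f g \<in> FI P"
  unfolding fi_commutator_def by (intro FI_diff FI_mult)

lemmas FI_closed = FI_0 FI_add FI_diff FI_scale FI_mult FI_commutator

lemma fi_mult_add_left:
  assumes "f \<in> FI P" "g \<in> FI P" "h \<in> FI P"
  shows "fi_mult P (f + g) h = fi_mult P f h + fi_mult P g h"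
proof (rule FI_eqI)
  fix x y assume xy: "x \<in> P" "y \<in> P"
  define S where "S = {z. x \<le> z \<and> h z y \<noteq> 0}"
  have "finite S" using FI_finite_column[OF assms(3) xy] by (simp add: S_def)
  then show "fi_mult P (f + g) h x y = (fi_mult P f h + fi_mult P g h) x y"
    using assms xy
    by (simp add: fi_mult_column[where S = S] S_def FI_closed sum.distrib distrib_right)
qed (simp_all add: assms FI_closed)

lemma fi_mult_add_right:
  assumes "f \<in> FI P" "g \<in> FI P" "h \<in> FI P"
  shows "fi_mult P f (g + h) = fi_mult P f g + fi_mult P f h"
proof (rule FI_eqI)
  fix x y assume xy: "x \<in> P" "y \<in> P"
  define S where "S = {z. z \<le> y \<and> f x z \<noteq> 0}"
  have "finite S" using FI_finite_row[OF assms(1) xy] by (simp add: S_def)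
  then show "fi_mult P f (g + h) x y = (fi_mult P f g + fi_mult P f h) x y"
    using assms xy
    by (simp add: fi_mult_row[where S = S] S_def FI_closed sum.distrib distrib_left)
qed (simp_all add: assms FI_closed)

lemma fi_mult_scale_left:
  assumes "f \<in> FI P" "g \<in> FI P"
  shows "fi_mult P (fi_scale r f) g = fi_scale r (fi_mult P f g)"
proof (rule FI_eqI)
  fix x y assume xy: "x \<in> P" "y \<in> P"
  define S where "S = {z. x \<le> z \<and> g z y \<noteq> 0}"
  have S: "finite S" using FI_finite_column[OF assms(2) xy] by (simp add: S_def)
  have "fi_mult P (fi_scale r f) g x y = (\<Sum>z\<in>S. fi_scale r f x z * g z y)"
    using assms xy S by (intro fi_mult_column) (auto simp: S_def FI_closed)
  moreover have "fi_mult P f g x y = (\<Sum>z\<in>S. f x z * g z y)"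
    using assms xy S by (intro fi_mult_column) (auto simp: S_def)
  ultimately show "fi_mult P (fi_scale r f) g x y = fi_scale r (fi_mult P f g) x y"
    by (simp add: fi_scale_def sum_distrib_left mult.assoc)
qed (simp_all add: assms FI_closed)

lemma fi_mult_scale_right:
  assumes "f \<in> FI P" "g \<in> FI P"
  shows "fi_mult P f (fi_scale r g) = fi_scale r (fi_mult P f g)"
proof (rule FI_eqI)
  fix x y assume xy: "x \<in> P" "y \<in> P"
  define S where "S = {z. z \<le> y \<and> f x z \<noteq> 0}"
  have S: "finite S" using FI_finite_row[OF assms(1) xy] by (simp add: S_def)
  have "fi_mult P f (fi_scale r g) x y = (\<Sum>z\<in>S. f x z * fi_scale r g z y)"
    using assms xy S by (intro fi_mult_row) (auto simp: S_def FI_closed)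
  moreover have "fi_mult P f g x y = (\<Sum>z\<in>S. f x z * g z y)"
    using assms xy S by (intro fi_mult_row) (auto simp: S_def)
  ultimately show "fi_mult P f (fi_scale r g) x y = fi_scale r (fi_mult P f g) x y"
    by (simp add: fi_scale_def sum_distrib_left mult.left_commute)
qed (simp_all add: assms FI_closed)

lemma fi_mult_diff_left:
  assumes "f \<in> FI P" "g \<in> FI P" "h \<in> FI P"
  shows "fi_mult P (f - g) h = fi_mult P f h - fi_mult P g h"
proof -
  have "fi_mult P f h = fi_mult P (f - g) h + fi_mult P g h"
    using fi_mult_add_left[OF FI_diff[OF assms(1,2)] assms(2,3)] by (simp only: diff_add_cancel)
  then show ?thesis by (simp only: add_diff_cancel_right')
qed

lemma fi_mult_diff_right:
  assumes "f \<in> FI P" "g \<in> FI P" "h \<in> FI P"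
  shows "fi_mult P f (g - h) = fi_mult P f g - fi_mult P f h"
proof -
  have "fi_mult P f g = fi_mult P f (g - h) + fi_mult P f h"
    using fi_mult_add_right[OF assms(1) FI_diff[OF assms(2,3)] assms(3)] by (simp only: diff_add_cancel)
  then show ?thesis by (simp only: add_diff_cancel_right')
qed

lemma fi_mult_assoc:
  assumes "f \<in> FI P" "g \<in> FI P" "h \<in> FI P"
  shows "fi_mult P (fi_mult P f g) h = fi_mult P f (fi_mult P g h)"
proof (rule FI_eqI)
  fix x y assume xy: "x \<in> P" "y \<in> P"
  \<comment> \<open>Both sets are independent of the inner summation index, so the double sum runs
    over the finite rectangle \<open>S\<close> times \<open>T\<close> and may be swapped.\<close>
  define S where "S = {z. z \<le> y \<and> f x z \<noteq> 0}"
  define T where "T = {w. x \<le> w \<and> h w y \<noteq> 0}"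
  have S: "finite S" using FI_finite_row[OF assms(1) xy] by (simp add: S_def)
  have T: "finite T" using FI_finite_column[OF assms(3) xy] by (simp add: T_def)
  have "fi_mult P (fi_mult P f g) h x y = (\<Sum>w\<in>T. fi_mult P f g x w * h w y)"
    using assms xy T by (intro fi_mult_column) (auto simp: T_def FI_closed)
  also have "\<dots> = (\<Sum>w\<in>T. (\<Sum>z\<in>S. f x z * g z w) * h w y)"
  proof (rule sum.cong[OF refl])
    fix w assume "w \<in> T"
    then have w: "w \<in> P" "w \<le> y" using FI_nonzeroD[OF assms(3)] by (auto simp: T_def)
    have "{z. z \<le> w \<and> f x z \<noteq> 0} \<subseteq> S" using w by (auto simp: S_def)
    then show "fi_mult P f g x w * h w y = (\<Sum>z\<in>S. f x z * g z w) * h w y"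
      using assms xy w S by (simp add: fi_mult_row[where S = S])
  qed
  also have "\<dots> = (\<Sum>z\<in>S. f x z * (\<Sum>w\<in>T. g z w * h w y))"
    by (simp add: sum_distrib_left sum_distrib_right mult.assoc sum.swap[of _ S T])
  also have "\<dots> = (\<Sum>z\<in>S. f x z * fi_mult P g h z y)"
  proof (rule sum.cong[OF refl])
    fix z assume "z \<in> S"
    then have z: "z \<in> P" "x \<le> z" using FI_nonzeroD[OF assms(1)] by (auto simp: S_def)
    have "{w. z \<le> w \<and> h w y \<noteq> 0} \<subseteq> T" using z by (auto simp: T_def)
    then show "f x z * (\<Sum>w\<in>T. g z w * h w y) = f x z * fi_mult P g h z y"
      using assms xy z T by (simp add: fi_mult_column[where S = T])
  qed
  also have "\<dots> = fi_mult P f (fi_mult P g h) x y"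
    using assms xy S by (intro fi_mult_row[symmetric]) (auto simp: S_def FI_closed)
  finally show "fi_mult P (fi_mult P f g) h x y = fi_mult P f (fi_mult P g h) x y" .
qed (simp_all add: assms FI_closed)

lemma fi_mult_diagonal:
  assumes "f \<in> FI P" "g \<in> FI P"
  shows "fi_mult P f g x x = f x x * g x x"
proof -
  have "fi_mult P f g x x = (\<Sum>z\<in>{x}. f x z * g z x)"
  proof (rule fi_mult_eq_sum[OF assms])
    fix z assume "f x z * g z x \<noteq> 0"
    then have "f x z \<noteq> 0" "g z x \<noteq> 0" by auto
    then show "z \<in> {x}"
      using FI_nonzeroD(3)[OF assms(1)] FI_nonzeroD(3)[OF assms(2)] by (force intro: antisym)
  qed simp
  then show ?thesis by simp
qed

lemma fi_commutator_diagonal: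
  assumes "f \<in> FI P" "g \<in> FI P"
  shows "fi_commutator P f g x x = 0"
  using assms by (simp add: fi_commutator_def fi_mult_diagonal mult.commute)

lemma fi_commutator_jacobi:
  assumes "f \<in> FI P" "g \<in> FI P" "h \<in> FI P"
  shows "fi_commutator P f (fi_commutator P g h) + fi_commutator P g (fi_commutator P h f)
    + fi_commutator P h (fi_commutator P f g) = 0"
  using assms
  by (simp add: fi_commutator_def fi_mult_diff_left fi_mult_diff_right FI_closed fi_mult_assoc)

lemma fi_commutator_leibniz:
  assumes "f \<in> FI P" "g \<in> FI P" "h \<in> FI P"
  shows "fi_commutator P f (fi_mult P g h) =
    fi_mult P (fi_commutator P f g) h + fi_mult P g (fi_commutator P f h)"
  using assms
  by (simp add: fi_commutator_def fi_mult_diff_left fi_mult_diff_right FI_closed fi_mult_assoc)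

section \<open>Matrix units\<close>

definition fi_unit :: "'p \<Rightarrow> 'p \<Rightarrow> 'p::order \<Rightarrow> 'p \<Rightarrow> 'r::{comm_ring,comm_monoid_mult}"
  where "fi_unit x y u v = (if u = x \<and> v = y then 1 else 0)"

lemma FI_unit:
  assumes "x \<in> P" "y \<in> P" "x \<le> y"
  shows "fi_unit x y \<in> FI P"
proof (rule FI_I)
  fix a b
  have "{(u, v). a \<le> u \<and> u < v \<and> v \<le> b \<and> fi_unit x y u v \<noteq> 0} \<subseteq> {(x, y)}"
    by (auto simp: fi_unit_def split: if_splits)
  then show "finite {(u, v). a \<le> u \<and> u < v \<and> v \<le> b \<and> fi_unit x y u v \<noteq> 0}"
    by (rule finite_subset) simp
qed (use assms in \<open>auto simp: fi_unit_def\<close>)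

lemma fi_mult_unit_left:
  assumes "x \<in> P" "y \<in> P" "x \<le> y" "f \<in> FI P"
  shows "fi_mult P (fi_unit x y) f u v = (if u = x then f y v else 0)"
proof -
  have "fi_mult P (fi_unit x y) f u v = (\<Sum>z\<in>{y}. fi_unit x y u z * f z v)"
    by (rule fi_mult_eq_sum) (use assms FI_unit in \<open>auto simp: fi_unit_def split: if_splits\<close>)
  then show ?thesis by (simp add: fi_unit_def)
qed

lemma fi_mult_unit_right:
  assumes "x \<in> P" "y \<in> P" "x \<le> y" "f \<in> FI P"
  shows "fi_mult P f (fi_unit x y) u v = (if v = y then f u x else 0)"
proof -
  have "fi_mult P f (fi_unit x y) u v = (\<Sum>z\<in>{x}. f u z * fi_unit x y z v)"
    by (rule fi_mult_eq_sum) (use assms FI_unit in \<open>auto simp: fi_unit_def split: if_splits\<close>)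
  then show ?thesis by (simp add: fi_unit_def)
qed

section \<open>Derivations\<close>

text \<open>Isolates the axioms that concern one argument of a bracket. It is instantiated with
  \<open>B (a, _)\<close> for various \<open>a\<close>; the other argument is reached by skew
  symmetry.\<close>

locale fi_derivation =
  fixes P :: "'p::order set"
    and D :: "('p \<Rightarrow> 'p \<Rightarrow> 'r::{comm_ring,comm_monoid_mult}) \<Rightarrow> 'p \<Rightarrow> 'p \<Rightarrow> 'r"
  assumes closed: "f \<in> FI P \<Longrightarrow> D f \<in> FI P"
    and add: "f \<in> FI P \<Longrightarrow> g \<in> FI P \<Longrightarrow> D (f + g) = D f + D g"
    and scale: "f \<in> FI P \<Longrightarrow> D (fi_scale r f) = fi_scale r (D f)"
    and leibniz: "f \<in> FI P \<Longrightarrow> g \<in> FI P \<Longrightarrow> D (fi_mult P f g) = fi_mult P (D f) g + fi_mult P f (D g)"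
begin

lemma zero: "D 0 = 0"
proof -
  have "fi_scale 0 f = 0" for f :: "'p \<Rightarrow> 'p \<Rightarrow> 'r" by (simp add: fi_scale_def fun_eq_iff)
  then show ?thesis using scale[OF FI_0, of 0] by simp
qed

lemma idempotent:
  assumes "x \<in> P"
  shows "D (fi_unit x x) = fi_mult P (D (fi_unit x x)) (fi_unit x x) + fi_mult P (fi_unit x x) (D (fi_unit x x))"
proof -
  have e: "(fi_unit x x :: 'p \<Rightarrow> 'p \<Rightarrow> 'r) \<in> FI P" using assms by (simp add: FI_unit)
  have "fi_mult P (fi_unit x x) (fi_unit x x) = (fi_unit x x :: 'p \<Rightarrow> 'p \<Rightarrow> 'r)"
    using assms e by (simp add: fi_mult_unit_left fi_unit_def fun_eq_iff)
  then show ?thesis using leibniz[OF e e] by simp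
qed

text \<open>Right multiplication by e_x keeps column \<open>x\<close> and left multiplication keeps
  row \<open>x\<close>, so D(e_x) = D(e_x) e_x + e_x D(e_x) confines D(e_x) to that row and column.
  At \<open>(x, x)\<close> the identity reads d = d + d, whence d = 0.\<close>

lemma idempotent_apply:
  assumes "x \<in> P"
  shows "D (fi_unit x x) u v =
    (if v = x then D (fi_unit x x) u x else 0) + (if u = x then D (fi_unit x x) x v else 0)"
proof -
  have "D (fi_unit x x) \<in> FI P" using assms by (simp add: FI_unit closed)
  then show ?thesis
    using arg_cong[OF idempotent[OF assms], of "\<lambda>h. h u v"] assms
    by (simp only: plus_fun_apply fi_mult_unit_left fi_mult_unit_right order_refl)
qed

lemma idempotent_off:
  assumes "x \<in> P" "u \<noteq> x" "v \<noteq> x"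
  shows "D (fi_unit x x) u v = 0"
  using idempotent_apply[OF assms(1), of u v] assms by simp

lemma idempotent_diagonal:
  assumes "x \<in> P"
  shows "D (fi_unit x x) x x = 0"
  using idempotent_apply[OF assms(1), of x x] by simp

lemma expand:
  assumes "x \<in> P" "y \<in> P" "x \<le> y" and f: "f \<in> FI P"
  shows "D f x y = f x y * D (fi_unit x y) x y
    - fi_mult P (D (fi_unit x x)) f x y - fi_mult P f (D (fi_unit y y)) x y"
proof -
  let ?ex = "fi_unit x x :: 'p \<Rightarrow> 'p \<Rightarrow> 'r" and ?ey = "fi_unit y y :: 'p \<Rightarrow> 'p \<Rightarrow> 'r"
  have e: "?ex \<in> FI P" "?ey \<in> FI P" "(fi_unit x y :: 'p \<Rightarrow> 'p \<Rightarrow> 'r) \<in> FI P" using assms by (simp_all add: FI_unit)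
  note D = closed[OF e(1)] closed[OF e(2)] closed[OF f]
  \<comment> \<open>\<open>D\<close> is not assumed to respect infinite sums of units. Compressing
    \<open>f\<close> between two idempotents leaves a scalar multiple of a single unit, to which
    \<open>scale\<close> applies.\<close>
  have "fi_mult P ?ex (fi_mult P f ?ey) = fi_scale (f x y) (fi_unit x y)"
    using assms e f
    by (simp add: fi_mult_unit_left fi_mult_unit_right FI_mult fi_scale_def fun_eq_iff fi_unit_def)
  then have "fi_scale (f x y) (D (fi_unit x y)) = D (fi_mult P ?ex (fi_mult P f ?ey))"
    using e by (simp add: scale)
  also have "\<dots> = fi_mult P (fi_mult P (D ?ex) f) ?ey
      + fi_mult P ?ex (fi_mult P (D f) ?ey + fi_mult P f (D ?ey))"
    using e f D by (simp add: leibniz FI_mult fi_mult_assoc)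
  finally have "fi_scale (f x y) (D (fi_unit x y)) x y = (fi_mult P (fi_mult P (D ?ex) f) ?ey
      + fi_mult P ?ex (fi_mult P (D f) ?ey + fi_mult P f (D ?ey))) x y"
    by (rule arg_cong)
  also have "\<dots> = fi_mult P (D ?ex) f x y + (D f x y + fi_mult P f (D ?ey) x y)"
    using assms e f D by (simp add: fi_mult_unit_left fi_mult_unit_right FI_closed)
  finally show ?thesis by (simp add: fi_scale_def algebra_simps)
qed

text \<open>For x = y every term of \<open>expand\<close> contains the entry D(e_x)(x,x), which
  vanishes.\<close>

lemma diagonal:
  assumes "f \<in> FI P"
  shows "D f x x = 0"
proof (cases "x \<in> P")
  case True
  then have "D (fi_unit x x) \<in> FI P" by (simp add: FI_unit closed)
  with True assms show ?thesis
    by (simp add: expand[of x x f] fi_mult_diagonal idempotent_diagonal)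
next
  case False
  then show ?thesis using FI_zero[OF closed[OF assms]] by blast
qed

end

section \<open>Poisson structures\<close>

locale fi_poisson =
  fixes P :: "'p::order set"
    and B :: "('p \<Rightarrow> 'p \<Rightarrow> 'r::{comm_ring,comm_monoid_mult}) \<times> ('p \<Rightarrow> 'p \<Rightarrow> 'r) \<Rightarrow> 'p \<Rightarrow> 'p \<Rightarrow> 'r"
  assumes poisson: "poisson_structure_on (FI P) (fi_mult P) fi_scale B"
begin

lemma closed: "f \<in> FI P \<Longrightarrow> g \<in> FI P \<Longrightarrow> B (f, g) \<in> FI P"
  using poisson unfolding poisson_structure_on_def lie_bracket_on_def by blast

lemma derivation: "a \<in> FI P \<Longrightarrow> fi_derivation P (\<lambda>f. B (a, f))"
  using poisson closed
  unfolding fi_derivation_def poisson_structure_on_def lie_bracket_on_def bilinear_on_def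
  by simp

lemma skew:
  assumes "a \<in> FI P" "b \<in> FI P"
  shows "B (a, b) = - B (b, a)"
proof -
  have add: "B (f + g, h) = B (f, h) + B (g, h)" if "f \<in> FI P" "g \<in> FI P" "h \<in> FI P" for f g h
    using poisson that unfolding poisson_structure_on_def lie_bracket_on_def bilinear_on_def by blast
  have alt: "B (f, f) = 0" if "f \<in> FI P" for f
    using poisson that unfolding poisson_structure_on_def lie_bracket_on_def by blast
  have "0 = B (a + b, a + b)" using assms by (simp add: alt FI_add)
  also have "\<dots> = (B (a, a) + B (a, b)) + (B (b, a) + B (b, b))"
    using assms by (simp add: add fi_derivation.add[OF derivation] FI_add)
  finally have "B (a, b) + B (b, a) = 0" using assms by (simp add: alt)
  then show ?thesis by (simp add: eq_neg_iff_add_eq_0)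
qed

lemma alternating: "a \<in> FI P \<Longrightarrow> B (a, a) = 0"
  using poisson unfolding poisson_structure_on_def lie_bracket_on_def by blast

lemma skew_apply: "a \<in> FI P \<Longrightarrow> b \<in> FI P \<Longrightarrow> B (a, b) x y = - B (b, a) x y"
  using skew[of a b] by simp

text \<open>For x distinct from z, B(e_x,e_z) is the value of a derivation at e_z and so lives in
  row \<open>z\<close> and column \<open>z\<close>. The Leibniz rule for B(e_z, -) on the zero
  products e_z e_x and e_x e_z, with B(e_z,e_z) = 0, kills exactly this row and column.\<close>

lemma bracket_idempotents:
  assumes x: "x \<in> P" and z: "z \<in> P"
  shows "B (fi_unit x x, fi_unit z z) = 0"
proof (cases "x = z")
  case True
  then show ?thesis using x by (simp add: alternating FI_unit)
next
  case False
  have orth: "fi_mult P (fi_unit u u) (B (fi_unit u u, fi_unit v v)) = 0 \<and>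
      fi_mult P (B (fi_unit u u, fi_unit v v)) (fi_unit u u) = 0"
    if u: "u \<in> P" and v: "v \<in> P" and uv: "u \<noteq> v" for u v
  proof -
    let ?u = "fi_unit u u :: 'p \<Rightarrow> 'p \<Rightarrow> 'r" and ?v = "fi_unit v v :: 'p \<Rightarrow> 'p \<Rightarrow> 'r"
    have e: "?u \<in> FI P" "?v \<in> FI P" using u v by (simp_all add: FI_unit)
    interpret D: fi_derivation P "\<lambda>f. B (?u, f)" by (rule derivation[OF e(1)])
    have z: "fi_mult P ?u ?v = 0" "fi_mult P ?v ?u = 0"
      using u v uv e by (simp_all add: fun_eq_iff fi_mult_unit_left) (simp_all add: fi_unit_def)
    show ?thesis
      using D.leibniz[OF e] D.leibniz[OF e(2,1)] e by (simp add: z fi_mult_zero D.zero alternating)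
  qed
  let ?x = "fi_unit x x :: 'p \<Rightarrow> 'p \<Rightarrow> 'r" and ?z = "fi_unit z z :: 'p \<Rightarrow> 'p \<Rightarrow> 'r"
  have e: "?x \<in> FI P" "?z \<in> FI P" using x z by (simp_all add: FI_unit)
  interpret D: fi_derivation P "\<lambda>f. B (?z, f)" by (rule derivation[OF e(2)])
  interpret D': fi_derivation P "\<lambda>f. B (?x, f)" by (rule derivation[OF e(1)])
  have "B (?x, ?z) u v = 0" for u v
  proof -
    have "B (?z, ?x) u z = 0" for u
      using fi_mult_unit_right[OF z z order_refl D.closed[OF e(1)], of u z] orth[OF z x] False by auto
    moreover have "B (?z, ?x) z v = 0" for v
      using fi_mult_unit_left[OF z z order_refl D.closed[OF e(1)], of z v] orth[OF z x] False by auto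
    ultimately have "B (?x, ?z) u z = 0" "B (?x, ?z) z v = 0" for u v
      using skew_apply[OF e] by simp_all
    then show ?thesis using D'.idempotent_apply[OF z, of u v] by simp
  qed
  then show ?thesis by (simp add: fun_eq_iff)
qed

text \<open>The candidate for \<sigma>: the commutator of e_x and e_xy has coefficient 1 at
  \<open>(x, y)\<close> when \<open>x < y\<close>, so no other value is possible. See
  \<open>weighted_commutator_unit\<close>.\<close>

definition weight :: "'p \<times> 'p \<Rightarrow> 'r"
  where "weight = (\<lambda>(x, y). B (fi_unit x x, fi_unit x y) x y)"

text \<open>In \<open>expand\<close> for the derivation B(e_x, -) both correction terms contain
  brackets of idempotents, which are zero.\<close>

lemma bracket_source:
  assumes "x \<in> P" "y \<in> P" "x \<le> y" "f \<in> FI P"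
  shows "B (fi_unit x x, f) x y = weight (x, y) * f x y"
proof -
  have e: "fi_unit x x \<in> FI P" using assms by (simp add: FI_unit)
  show ?thesis
    using assms
    by (simp add: fi_derivation.expand[OF derivation[OF e]] bracket_idempotents weight_def fi_mult_zero mult.commute)
qed

text \<open>For x distinct from y the sum k = e_x + e_y is again idempotent. In B(e_xy,k) =
  B(e_xy,k) k + k B(e_xy,k) the entry at \<open>(x, y)\<close> occurs once on the left and twice on
  the right, so it vanishes; hence the contributions of e_x and e_y are opposite.\<close>

lemma bracket_target_unit:
  assumes xy: "x \<in> P" "y \<in> P" "x < y"
  shows "B (fi_unit y y, fi_unit x y) x y = - weight (x, y)"
proof -
  let ?x = "fi_unit x x :: 'p \<Rightarrow> 'p \<Rightarrow> 'r" and ?y = "fi_unit y y :: 'p \<Rightarrow> 'p \<Rightarrow> 'r"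
    and ?e = "fi_unit x y :: 'p \<Rightarrow> 'p \<Rightarrow> 'r"
  have e: "?x \<in> FI P" "?y \<in> FI P" "?e \<in> FI P" using xy by (simp_all add: FI_unit)
  interpret D: fi_derivation P "\<lambda>f. B (?e, f)" by (rule derivation[OF e(3)])
  let ?k = "?x + ?y"
  have k: "?k \<in> FI P" using e by (simp add: FI_add)
  have "fi_mult P ?k ?k = ?k"
    using xy e
    by (simp add: fi_mult_add_left FI_add fi_mult_add_right fun_eq_iff fi_mult_unit_left)
      (auto simp: fi_unit_def)
  then have "B (?e, ?k) = fi_mult P (B (?e, ?k)) ?k + fi_mult P ?k (B (?e, ?k))"
    using D.leibniz[OF k k] by simp
  then have "B (?e, ?k) x y = (fi_mult P (B (?e, ?k)) ?k + fi_mult P ?k (B (?e, ?k))) x y"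
    by (rule arg_cong)
  also have "\<dots> = B (?e, ?k) x y + B (?e, ?k) x y"
    using xy less_imp_neq[OF xy(3)] e D.closed[OF k]
    by (simp add: fi_mult_add_left fi_mult_add_right fi_mult_unit_left fi_mult_unit_right)
  finally have "B (?e, ?x) x y + B (?e, ?y) x y = 0"
    using e by (simp add: D.add)
  then show ?thesis
    using skew_apply[OF e(1,3), of x y] skew_apply[OF e(2,3), of x y]
    by (simp add: weight_def add_eq_0_iff)
qed

lemma bracket_target:
  assumes xy: "x \<in> P" "y \<in> P" "x < y" "f \<in> FI P"
  shows "B (fi_unit y y, f) x y = - (weight (x, y) * f x y)"
proof -
  have e: "fi_unit y y \<in> FI P" using assms by (simp add: FI_unit)
  show ?thesis
    using assms
    by (simp add: fi_derivation.expand[OF derivation[OF e]] bracket_idempotents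
        bracket_target_unit fi_mult_zero mult.commute)
qed

lemma weight_extend:
  assumes P: "x \<in> P" "y \<in> P" "w \<in> P" and less: "x < y" "y < w"
  shows "weight (x, w) = weight (x, y)" "weight (x, w) = weight (y, w)"
proof -
  let ?a = "fi_unit x y :: 'p \<Rightarrow> 'p \<Rightarrow> 'r" and ?b = "fi_unit y w :: 'p \<Rightarrow> 'p \<Rightarrow> 'r"
  have xw: "x < w" using less by (rule order.strict_trans)
  have e: "?a \<in> FI P" "?b \<in> FI P" "fi_unit x x \<in> FI P" "fi_unit w w \<in> FI P"
    using P less by (simp_all add: FI_unit)
  have ab: "fi_mult P ?a ?b = fi_unit x w"
    using P less e by (simp add: fi_mult_unit_left fun_eq_iff fi_unit_def)
  have eval: "B (c, fi_unit x w) x w = B (c, ?a) x y + B (c, ?b) y w" if "c \<in> FI P" for c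
    using fi_derivation.leibniz[OF derivation[OF that] e(1,2)] P less e closed[OF that e(1)] closed[OF that e(2)]
    by (simp add: ab fi_mult_unit_left fi_mult_unit_right)
  \<comment> \<open>By skew symmetry this is a derivation applied to e_x, which is supported in row
    and column \<open>x\<close>, while \<open>y\<close> and \<open>w\<close> both differ from
    \<open>x\<close>. The same argument with e_w serves the second equation.\<close>
  have "B (fi_unit x x, ?b) y w = 0"
    using fi_derivation.idempotent_off[OF derivation[OF e(2)] P(1), of y w] less xw
      skew_apply[OF e(3,2), of y w] by auto
  then show "weight (x, w) = weight (x, y)"
    using eval[OF e(3)] by (simp add: weight_def)
  have "B (fi_unit w w, ?a) x y = 0"
    using fi_derivation.idempotent_off[OF derivation[OF e(1)] P(3), of x y] less xw
      skew_apply[OF e(4,1), of x y] by auto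
  then show "weight (x, w) = weight (y, w)"
    using eval[OF e(4)] P less xw by (simp add: bracket_target_unit)
qed

text \<open>This is \<open>expand\<close> for B(f, -) with both correction terms evaluated. The
  bracket with e_xy is left standing and is eliminated in \<open>bracket_apply\<close>.\<close>

lemma bracket_apply_unit:
  assumes xy: "x \<in> P" "y \<in> P" "x < y" and f: "f \<in> FI P" and g: "g \<in> FI P"
  shows "B (f, g) x y = weight (x, y) * (fi_commutator P f g x y - f x x * g x y + f y y * g x y)
    - g x y * B (fi_unit x y, f) x y"
proof -
  let ?x = "fi_unit x x :: 'p \<Rightarrow> 'p \<Rightarrow> 'r" and ?y = "fi_unit y y :: 'p \<Rightarrow> 'p \<Rightarrow> 'r"
    and ?e = "fi_unit x y :: 'p \<Rightarrow> 'p \<Rightarrow> 'r" and ?s = "weight (x, y)"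
  have e: "?x \<in> FI P" "?y \<in> FI P" "?e \<in> FI P" using xy by (simp_all add: FI_unit)
  \<comment> \<open>Only entries \<open>(x, z)\<close> with \<open>z\<close> in the interval matter.
    There the weight of \<open>(x, z)\<close> equals \<open>?s\<close> by
    \<open>weight_extend\<close>, and subtracting the diagonal part of \<open>f\<close> accounts for
    the vanishing entry at \<open>z = x\<close>.\<close>
  have "fi_mult P (B (f, ?x)) g x y = fi_mult P (fi_scale (- ?s) (f - fi_scale (f x x) ?x)) g x y"
  proof (rule fi_mult_cong)
    fix z assume z: "z \<in> P" "x \<le> z" "z \<le> y"
    have "B (f, ?x) x z = - B (?x, f) x z" by (rule skew_apply[OF f e(1)])
    also have "\<dots> = fi_scale (- ?s) (f - fi_scale (f x x) ?x) x z"
    proof (cases "z = x")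
      case True
      then show ?thesis
        by (simp add: fi_derivation.diagonal[OF derivation[OF e(1)] f] fi_scale_def) (simp add: fi_unit_def)
    next
      case False
      then have "x < z" using z by simp
      then have "weight (x, z) = ?s"
        using weight_extend(1)[of x z y] xy z by (cases "z = y") auto
      then show ?thesis using False xy z f
        by (simp add: bracket_source fi_scale_def) (simp add: fi_unit_def)
    qed
    finally show "B (f, ?x) x z * g z y = fi_scale (- ?s) (f - fi_scale (f x x) ?x) x z * g z y"
      by simp
  qed
  also have "\<dots> = - ?s * (fi_mult P f g x y - f x x * g x y)"
    using e f g xy
    by (simp add: fi_mult_scale_left fi_mult_diff_left FI_closed)
      (simp add: fi_scale_def fi_mult_unit_left)
  finally have left: "fi_mult P (B (f, ?x)) g x y = - ?s * (fi_mult P f g x y - f x x * g x y)" .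
  have "fi_mult P g (B (f, ?y)) x y = fi_mult P g (fi_scale ?s (f - fi_scale (f y y) ?y)) x y"
  proof (rule fi_mult_cong)
    fix z assume z: "z \<in> P" "x \<le> z" "z \<le> y"
    have "B (f, ?y) z y = - B (?y, f) z y" by (rule skew_apply[OF f e(2)])
    also have "\<dots> = fi_scale ?s (f - fi_scale (f y y) ?y) z y"
    proof (cases "z = y")
      case True
      then show ?thesis
        by (simp add: fi_derivation.diagonal[OF derivation[OF e(2)] f] fi_scale_def) (simp add: fi_unit_def)
    next
      case False
      then have "z < y" using z by simp
      moreover from this have "weight (z, y) = ?s"
        using weight_extend(2)[of x z y] xy z by (cases "z = x") auto
      ultimately show ?thesis using False xy z f
        by (simp add: bracket_target fi_scale_def) (simp add: fi_unit_def)
    qed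
    finally show "g x z * B (f, ?y) z y = g x z * fi_scale ?s (f - fi_scale (f y y) ?y) z y"
      by simp
  qed
  also have "\<dots> = ?s * (fi_mult P g f x y - f y y * g x y)"
    using e f g xy
    by (simp add: fi_mult_scale_right fi_mult_diff_right FI_closed)
      (simp add: fi_scale_def fi_mult_unit_right)
  finally have right: "fi_mult P g (B (f, ?y)) x y = ?s * (fi_mult P g f x y - f y y * g x y)" .
  have "B (f, g) x y = g x y * B (f, ?e) x y - fi_mult P (B (f, ?x)) g x y - fi_mult P g (B (f, ?y)) x y"
    using xy by (intro fi_derivation.expand[OF derivation[OF f]] g) auto
  then show ?thesis
    unfolding left right skew_apply[OF f e(3), of x y]
    by (simp add: fi_commutator_def algebra_simps)
qed

lemma bracket_apply:
  assumes xy: "x \<in> P" "y \<in> P" "x < y" and f: "f \<in> FI P" and g: "g \<in> FI P"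
  shows "B (f, g) x y = weight (x, y) * fi_commutator P f g x y"
proof -
  have e: "fi_unit x y \<in> FI P" using xy by (simp add: FI_unit)
  \<comment> \<open>The formula of \<open>bracket_apply_unit\<close> is applied to its own
    remainder. Now the leftover bracket is B(e_xy,e_xy) = 0 and the diagonal entries of e_xy vanish.
    The resulting value cancels the diagonal corrections in the formula for \<open>f\<close> and
    \<open>g\<close>.\<close>
  have "B (fi_unit x y, f) x y = weight (x, y) * fi_commutator P (fi_unit x y) f x y"
    using bracket_apply_unit[OF xy e f] xy by (simp add: alternating e) (simp add: fi_unit_def)
  also have "fi_commutator P (fi_unit x y) f x y = f y y - f x x"
    using xy f by (simp add: fi_commutator_def fi_mult_unit_left fi_mult_unit_right)
  finally show ?thesis
    by (simp only: bracket_apply_unit[OF xy f g]) (simp add: algebra_simps)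
qed

lemma weight_subinterval:
  assumes "m \<in> P" "x \<in> P" "y \<in> P" "M \<in> P" "m \<le> x" "x < y" "y \<le> M"
  shows "weight (x, y) = weight (m, M)"
proof -
  have "weight (x, y) = weight (m, y)"
    using weight_extend(2)[of m x y] assms by (cases "m = x") auto
  also have "\<dots> = weight (m, M)"
    using weight_extend(1)[of m y M] assms by (cases "y = M") auto
  finally show ?thesis .
qed

text \<open>In a chain the two lower ends have a minimum \<open>m\<close> and the two upper ends a
  maximum \<open>M\<close>, so both pairs lie in one interval, whose weight they share.\<close>

lemma weight_constant_on_chains: "constant_on_chains P (restrict weight (strict_pairs P))"
  unfolding constant_on_chains_def
proof (intro allI impI ballI)
  fix C x y u v
  assume C: "C \<subseteq> P" "Complete_Partial_Order.chain (\<le>) C"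
    and mem: "x \<in> C" "y \<in> C" "u \<in> C" "v \<in> C" and less: "x < y" "u < v"
  obtain m where m: "m \<in> C" "m \<le> x" "m \<le> u" using chainD[OF C(2) mem(1,3)] mem by auto
  obtain M where M: "M \<in> C" "y \<le> M" "v \<le> M" using chainD[OF C(2) mem(2,4)] mem by auto
  have "weight (x, y) = weight (m, M)" "weight (u, v) = weight (m, M)"
    using m M mem less C(1) by (auto intro!: weight_subinterval)
  then show "restrict weight (strict_pairs P) (x, y) = restrict weight (strict_pairs P) (u, v)"
    using mem less C(1) by (auto simp: strict_pairs_def)
qed

end

section \<open>Commutators weighted by a map that is constant on chains\<close>

definition weighted_commutator ::
    "'p::order set \<Rightarrow> ('p \<times> 'p \<Rightarrow> 'r) \<Rightarrow> ('p \<Rightarrow> 'p \<Rightarrow> 'r) \<Rightarrow> ('p \<Rightarrow> 'p \<Rightarrow> 'r)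
      \<Rightarrow> 'p \<Rightarrow> 'p \<Rightarrow> 'r::{comm_ring,comm_monoid_mult}"
  where "weighted_commutator P \<sigma> f g =
    (\<lambda>x y. if (x, y) \<in> strict_pairs P then \<sigma> (x, y) * fi_commutator P f g x y else 0)"

lemma FI_weighted_commutator:
  assumes "f \<in> FI P" "g \<in> FI P"
  shows "weighted_commutator P \<sigma> f g \<in> FI P"
proof -
  have "weighted_commutator P \<sigma> f g =
      (\<lambda>x y. (if (x, y) \<in> strict_pairs P then \<sigma> (x, y) else 0) * fi_commutator P f g x y)"
    by (auto simp: weighted_commutator_def fun_eq_iff)
  then show ?thesis by (simp only: FI_weighted[OF FI_commutator[OF assms]])
qed

lemma constant_on_chains_subinterval:
  assumes "constant_on_chains P \<sigma>" "x \<in> P" "u \<in> P" "v \<in> P" "y \<in> P" "x \<le> u" "u < v" "v \<le> y"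
  shows "\<sigma> (u, v) = \<sigma> (x, y)"
proof -
  let ?C = "{x, u, v, y}"
  have le: "x \<le> v" "u \<le> y" "x < y"
    using order.trans[OF assms(6) less_imp_le[OF assms(7)]] order.trans[OF less_imp_le[OF assms(7)] assms(8)]
      order.strict_trans1[OF assms(6) order.strict_trans2[OF assms(7,8)]] by simp_all
  then have chain: "Complete_Partial_Order.chain (\<le>) ?C"
    using assms(6-8) by (simp add: chain_def less_imp_le)
  have "?C \<subseteq> P" using assms(2-5) by simp
  from assms(1)[unfolded constant_on_chains_def, rule_format, OF this chain _ _ _ _ assms(7) le(3)]
  show ?thesis by simp
qed

text \<open>Any \<open>u < v\<close> in the interval lie on one chain with \<open>x\<close> and
  \<open>y\<close>, so \<sigma> acts there as a single scalar. For \<open>u = v\<close> both sides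
  vanish, since commutators have zero diagonal; the value of \<sigma> at a diagonal pair is
  therefore harmless.\<close>

lemma weighted_commutator_scale:
  assumes "constant_on_chains P \<sigma>" "x \<in> P" "u \<in> P" "v \<in> P" "y \<in> P" "x \<le> u" "u \<le> v" "v \<le> y"
    "f \<in> FI P" "g \<in> FI P"
  shows "weighted_commutator P \<sigma> f g u v = fi_scale (\<sigma> (x, y)) (fi_commutator P f g) u v"
proof (cases "u = v")
  case True
  then show ?thesis
    using assms by (simp add: weighted_commutator_def strict_pairs_def fi_scale_def fi_commutator_diagonal)
next
  case False
  then have "\<sigma> (u, v) = \<sigma> (x, y)"
    using assms by (intro constant_on_chains_subinterval) auto
  with False assms show ?thesis
    by (simp add: weighted_commutator_def strict_pairs_def fi_scale_def less_le)
qed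

text \<open>A product at \<open>(x, y)\<close> sees only entries inside the interval, where the
  weighted commutator is a scalar multiple of the commutator; the scalar can be pulled out.\<close>

lemma fi_mult_weighted_commutator:
  assumes "constant_on_chains P \<sigma>" "x \<in> P" "y \<in> P" "f \<in> FI P" "g \<in> FI P" "h \<in> FI P"
  shows "fi_mult P (weighted_commutator P \<sigma> f g) h x y = \<sigma> (x, y) * fi_mult P (fi_commutator P f g) h x y"
    and "fi_mult P h (weighted_commutator P \<sigma> f g) x y = \<sigma> (x, y) * fi_mult P h (fi_commutator P f g) x y"
proof -
  have "fi_mult P (weighted_commutator P \<sigma> f g) h x y = fi_mult P (fi_scale (\<sigma> (x, y)) (fi_commutator P f g)) h x y"
    using assms by (intro fi_mult_cong) (simp add: weighted_commutator_scale[of P \<sigma> x _ _ y])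
  then show "fi_mult P (weighted_commutator P \<sigma> f g) h x y = \<sigma> (x, y) * fi_mult P (fi_commutator P f g) h x y"
    using assms by (simp add: fi_mult_scale_left FI_commutator) (simp add: fi_scale_def)
  have "fi_mult P h (weighted_commutator P \<sigma> f g) x y = fi_mult P h (fi_scale (\<sigma> (x, y)) (fi_commutator P f g)) x y"
    using assms by (intro fi_mult_cong) (simp add: weighted_commutator_scale[of P \<sigma> x _ _ y])
  then show "fi_mult P h (weighted_commutator P \<sigma> f g) x y = \<sigma> (x, y) * fi_mult P h (fi_commutator P f g) x y"
    using assms by (simp add: fi_mult_scale_right FI_commutator) (simp add: fi_scale_def)
qed

text \<open>Inner and outer bracket contribute the same scalar at \<open>(x, y)\<close>. With this
  common factor \<sigma>(x,y)^2 the Jacobi identity reduces to that of the commutator.\<close>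

lemma weighted_commutator_nested:
  assumes "constant_on_chains P \<sigma>" "f \<in> FI P" "g \<in> FI P" "h \<in> FI P"
  shows "weighted_commutator P \<sigma> f (weighted_commutator P \<sigma> g h) x y =
    (if (x, y) \<in> strict_pairs P
     then \<sigma> (x, y) * \<sigma> (x, y) * fi_commutator P f (fi_commutator P g h) x y else 0)"
proof -
  have "fi_commutator P f (weighted_commutator P \<sigma> g h) x y
      = \<sigma> (x, y) * fi_commutator P f (fi_commutator P g h) x y" if "x \<in> P" "y \<in> P"
    using fi_mult_weighted_commutator[OF assms(1) that assms(3,4,2)]
    unfolding fi_commutator_def[of P f] by (simp add: right_diff_distrib)
  then show ?thesis
    by (simp add: weighted_commutator_def[of P \<sigma> f] strict_pairs_def mult.assoc)
qed

lemma weighted_commutator_leibniz: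
  assumes "constant_on_chains P \<sigma>" "f \<in> FI P" "g \<in> FI P" "h \<in> FI P"
  shows "weighted_commutator P \<sigma> f (fi_mult P g h) =
    fi_mult P (weighted_commutator P \<sigma> f g) h + fi_mult P g (weighted_commutator P \<sigma> f h)"
proof (rule FI_eqI)
  fix x y assume xy: "x \<in> P" "y \<in> P" "x \<le> y"
  have "weighted_commutator P \<sigma> f (fi_mult P g h) x y = \<sigma> (x, y) * fi_commutator P f (fi_mult P g h) x y"
    \<comment> \<open>Taking the subinterval to be the whole interval covers \<open>x = y\<close> as
      well, so no case split is needed.\<close>
    using weighted_commutator_scale[of P \<sigma> x x y y f "fi_mult P g h"] xy assms
    by (simp add: FI_mult fi_scale_def)
  then show "weighted_commutator P \<sigma> f (fi_mult P g h) x y =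
      (fi_mult P (weighted_commutator P \<sigma> f g) h + fi_mult P g (weighted_commutator P \<sigma> f h)) x y"
    using assms xy by (simp add: fi_mult_weighted_commutator fi_commutator_leibniz distrib_left)
qed (simp_all add: assms FI_closed FI_weighted_commutator)

lemma weighted_commutator_jacobi:
  assumes "constant_on_chains P \<sigma>" "f \<in> FI P" "g \<in> FI P" "h \<in> FI P"
  shows "weighted_commutator P \<sigma> f (weighted_commutator P \<sigma> g h)
    + weighted_commutator P \<sigma> g (weighted_commutator P \<sigma> h f)
    + weighted_commutator P \<sigma> h (weighted_commutator P \<sigma> f g) = 0"
proof -
  have "fi_commutator P f (fi_commutator P g h) x y + fi_commutator P g (fi_commutator P h f) x y
      + fi_commutator P h (fi_commutator P f g) x y = 0" for x y
    using fun_cong[OF fun_cong[OF fi_commutator_jacobi[OF assms(2-4)], of x], of y] by simp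
  then show ?thesis
    using assms by (simp add: fun_eq_iff weighted_commutator_nested flip: distrib_left)
qed

lemma weighted_commutator_bilinear:
  assumes "f \<in> FI P" "g \<in> FI P" "h \<in> FI P"
  shows "weighted_commutator P \<sigma> (f + g) h = weighted_commutator P \<sigma> f h + weighted_commutator P \<sigma> g h"
    and "weighted_commutator P \<sigma> f (g + h) = weighted_commutator P \<sigma> f g + weighted_commutator P \<sigma> f h"
    and "weighted_commutator P \<sigma> (fi_scale r f) g = fi_scale r (weighted_commutator P \<sigma> f g)"
    and "weighted_commutator P \<sigma> f (fi_scale r g) = fi_scale r (weighted_commutator P \<sigma> f g)"
  using assms
  by (simp_all add: weighted_commutator_def fun_eq_iff fi_commutator_def fi_mult_add_left
      fi_mult_add_right fi_mult_scale_left fi_mult_scale_right)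
    (simp_all add: fi_scale_def fi_commutator_def algebra_simps)

lemma poisson_weighted_commutator:
  assumes "constant_on_chains P \<sigma>"
  shows "poisson_structure_on (FI P) (fi_mult P) fi_scale
    (\<lambda>(f, g) \<in> FI P \<times> FI P. weighted_commutator P \<sigma> f g)"
proof -
  have "weighted_commutator P \<sigma> f f = 0" for f
    by (simp add: weighted_commutator_def fi_commutator_def fun_eq_iff)
  then show ?thesis
    unfolding poisson_structure_on_def lie_bracket_on_def bilinear_on_def
    using assms
    by (auto simp: FI_closed FI_weighted_commutator weighted_commutator_bilinear
        weighted_commutator_leibniz weighted_commutator_jacobi)
qed

lemma weighted_commutator_unit:
  fixes \<sigma> :: "'p::order \<times> 'p \<Rightarrow> 'r::{comm_ring,comm_monoid_mult}"
  assumes "(x, y) \<in> strict_pairs P"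
  shows "weighted_commutator P \<sigma> (fi_unit x x) (fi_unit x y) x y = \<sigma> (x, y)"
proof -
  have xy: "x \<in> P" "y \<in> P" "x < y" using assms by (auto simp: strict_pairs_def)
  then have "fi_commutator P (fi_unit x x) (fi_unit x y) x y = (1 :: 'r)"
    by (simp add: fi_commutator_def fi_mult_unit_left fi_mult_unit_right FI_unit)
      (auto simp: fi_unit_def)
  then show ?thesis using assms by (simp add: weighted_commutator_def)
qed

section \<open>Bijectivity of the correspondence\<close>

theorem theorem4p3:
  fixes P :: "'p::order set"
  shows "bij_betw
    (\<lambda>\<sigma> :: 'p \<times> 'p \<Rightarrow> 'r::{comm_ring,comm_monoid_mult}.
      \<lambda>(f, g) \<in> FI P \<times> FI P. \<lambda>x y.
        if (x, y) \<in> strict_pairs P then \<sigma> (x, y) * fi_commutator P f g x y else 0)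
    {\<sigma> \<in> strict_pairs P \<rightarrow>\<^sub>E UNIV. constant_on_chains P \<sigma>}
    {B \<in> FI P \<times> FI P \<rightarrow>\<^sub>E FI P. poisson_structure_on (FI P) (fi_mult P) fi_scale B}"
  (is "bij_betw _ ?S ?T")
  unfolding weighted_commutator_def[symmetric]
proof (rule bij_betwI')
  let ?\<Phi> = "\<lambda>\<sigma> :: 'p \<times> 'p \<Rightarrow> 'r. \<lambda>(f, g) \<in> FI P \<times> FI P. weighted_commutator P \<sigma> f g"
  show "?\<Phi> \<sigma> = ?\<Phi> \<tau> \<longleftrightarrow> \<sigma> = \<tau>" if "\<sigma> \<in> ?S" "\<tau> \<in> ?S" for \<sigma> \<tau>
  proof
    assume eq: "?\<Phi> \<sigma> = ?\<Phi> \<tau>"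
    \<comment> \<open>Injectivity: evaluating the bracket on e_x and e_xy at \<open>(x, y)\<close>
      recovers the value of \<sigma>. Off \<open>strict_pairs P\<close> both maps are
      \<open>undefined\<close>, so agreement on strict pairs suffices.\<close>
    have "\<sigma> p = \<tau> p" if "p \<in> strict_pairs P" for p
    proof -
      obtain x y where p: "p = (x, y)" by (rule prod.exhaust)
      let ?u = "fi_unit x x :: 'p \<Rightarrow> 'p \<Rightarrow> 'r" and ?v = "fi_unit x y :: 'p \<Rightarrow> 'p \<Rightarrow> 'r"
      have "?u \<in> FI P" "?v \<in> FI P" using \<open>p \<in> strict_pairs P\<close> p by (auto simp: strict_pairs_def FI_unit)
      then have "weighted_commutator P \<sigma> ?u ?v = weighted_commutator P \<tau> ?u ?v"
        using fun_cong[OF eq, of "(?u, ?v)"] by simp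
      then show ?thesis
        using \<open>p \<in> strict_pairs P\<close> by (simp add: p flip: weighted_commutator_unit[of x y P])
    qed
    moreover have "\<sigma> \<in> strict_pairs P \<rightarrow>\<^sub>E UNIV" "\<tau> \<in> strict_pairs P \<rightarrow>\<^sub>E UNIV"
      using that by blast+
    ultimately show "\<sigma> = \<tau>" by (intro PiE_ext)
  qed simp
  show "?\<Phi> \<sigma> \<in> ?T" if "\<sigma> \<in> ?S" for \<sigma>
    using that by (auto simp: poisson_weighted_commutator FI_weighted_commutator)
  show "\<exists>\<sigma>\<in>?S. B = ?\<Phi> \<sigma>" if B: "B \<in> ?T" for B
  proof -
    have B_fun: "B \<in> FI P \<times> FI P \<rightarrow>\<^sub>E FI P"
      and poisson: "poisson_structure_on (FI P) (fi_mult P) fi_scale B"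
      using B by blast+
    interpret fi_poisson P B by unfold_locales (fact poisson)
    \<comment> \<open>Restriction replaces the values of \<open>weight\<close> outside
      \<open>strict_pairs P\<close> by the default of the extensional function space.\<close>
    let ?\<sigma> = "restrict weight (strict_pairs P)"
    have "B (f, g) = weighted_commutator P ?\<sigma> f g" if fg: "f \<in> FI P" "g \<in> FI P" for f g
    proof (rule FI_eqI)
      fix x y assume xy: "x \<in> P" "y \<in> P" "x \<le> y"
      show "B (f, g) x y = weighted_commutator P ?\<sigma> f g x y"
      proof (cases "x = y")
        case True
        then show ?thesis using fi_derivation.diagonal[OF derivation] fg
          by (simp add: weighted_commutator_def strict_pairs_def)
      next
        case False
        with xy have "x < y" by simp
        then show ?thesis using xy fg
          by (simp add: weighted_commutator_def strict_pairs_def bracket_apply)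
      qed
    qed (simp_all add: fg closed FI_weighted_commutator)
    then have "B = ?\<Phi> ?\<sigma>"
      by (intro PiE_ext[OF B_fun]) (auto simp: FI_weighted_commutator)
    moreover have "?\<sigma> \<in> ?S" using weight_constant_on_chains by simp
    ultimately show ?thesis by (rule bexI)
  qed
qed

end
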